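(* Let $A,B$ be real symmetric $4\times 4$ matrices defining quadrics $\mathcal A: X^TAX=0$, $\mathcal B: X^TBX=0$ in $\mathbb{PR}^3$ with $f(\lambda)=\det(\lambda A-B)$ not identically zero. If $f(\lambda)=0$ has two identical pairs of complex conjugate roots with Segre characteristic $[(11)(11)]$, then the only possible index sequence is $\langle 2\rangle$, and in this case the QSIC comprises two non-intersecting real lines and two non-intersecting imaginary lines.
   Context: $X=(x,y,z,w)^T$ homogeneous coordinates; QSIC $=\mathcal A\cap\mathcal B$ (over $\mathbb C$). One may take $A$ nonsingular. Segre characteristic $[(11)(11)]$: $A^{-1}B$ has two distinct eigenvalues (here complex conjugate), each with two $1\times1$ Jordan blocks. $\mathrm{Id}(\lambda)$ = number of positive eigenvalues of $\lambda A-B$; when $f$ has no real root, the index sequence is $\langle s_0\rangle$ with $s_0$ the constant value of $\mathrm{Id}$ on $\mathbb R$. A line is real if it has infinitely many real points, imaginary otherwise. *)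

theory Defs
  imports "Jordan_Normal_Form.Jordan_Normal_Form" "Jordan_Normal_Form.Char_Poly"
begin

definition pencil_poly :: "real mat \<Rightarrow> real mat \<Rightarrow> real poly" where
  "pencil_poly A B = det (mat 4 4 (\<lambda>(i,j). [:- (B $$ (i,j)), A $$ (i,j):]))"

definition num_pos_eig :: "real mat \<Rightarrow> nat" where
  "num_pos_eig M = (\<Sum>x\<in>{x. x > 0 \<and> poly (char_poly M) x = 0}. order x (char_poly M))"

definition Id_pencil :: "real mat \<Rightarrow> real mat \<Rightarrow> real \<Rightarrow> nat" where
  "Id_pencil A B lam = num_pos_eig (lam \<cdot>\<^sub>m A - B)"

definition cmat :: "real mat \<Rightarrow> complex mat" where
  "cmat M = map_mat complex_of_real M"

text \<open>Lines of complex projective 3-space, represented by their 2-dimensional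
  linear subspaces of C^4 (given as the span of two independent vectors).\<close>
definition span2 :: "complex vec \<Rightarrow> complex vec \<Rightarrow> complex vec set" where
  "span2 u v = {a \<cdot>\<^sub>v u + b \<cdot>\<^sub>v v | a b. True}"

definition is_line :: "complex vec set \<Rightarrow> bool" where
  "is_line L \<longleftrightarrow> (\<exists>u v. u \<in> carrier_vec 4 \<and> v \<in> carrier_vec 4 \<and>
      (\<forall>a b. a \<cdot>\<^sub>v u + b \<cdot>\<^sub>v v = 0\<^sub>v 4 \<longrightarrow> a = 0 \<and> b = 0) \<and> L = span2 u v)"

definition proj_pt :: "complex vec \<Rightarrow> complex vec set" where
  "proj_pt w = {a \<cdot>\<^sub>v w | a. True}"

definition real_points :: "complex vec set \<Rightarrow> complex vec set set" where
  "real_points L = {proj_pt w | w. w \<in> L \<and> w \<noteq> 0\<^sub>v 4 \<and> (\<forall>i<4. w $ i \<in> \<real>)}"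

definition real_line :: "complex vec set \<Rightarrow> bool" where
  "real_line L \<longleftrightarrow> infinite (real_points L)"

definition qsic :: "real mat \<Rightarrow> real mat \<Rightarrow> complex vec set" where
  "qsic A B = {X \<in> carrier_vec 4. X \<noteq> 0\<^sub>v 4 \<and> X \<bullet> (cmat A *\<^sub>v X) = 0 \<and> X \<bullet> (cmat B *\<^sub>v X) = 0}"

end

theory Submission
  imports Defs "Jordan_Normal_Form.Jordan_Normal_Form_Uniqueness"
    "Jordan_Normal_Form.Jordan_Normal_Form_Existence"
begin

text \<open>
  The eigenspace \<open>E = {e. B e = \<alpha> A e}\<close> is a plane, \<open>\<complex>\<^sup>4\<close> is the direct sum of \<open>E\<close> and its conjugate, and
  this sum is orthogonal for the bilinear forms of \<open>A\<close> and \<open>B\<close>. On \<open>E\<close> the form of \<open>A\<close> is a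
  nondegenerate binary quadratic form, so \<open>E\<close> has a basis \<open>p, q\<close> of isotropic vectors. In the
  coordinates \<open>a p + b q + c p\<^sup>* + d q\<^sup>*\<close>, where \<open>p\<^sup>*, q\<^sup>*\<close> are the conjugates, the two quadrics
  intersect in \<open>a b = 0, c d = 0\<close>: the real lines \<open>\<langle>p, p\<^sup>*\<rangle>\<close>, \<open>\<langle>q, q\<^sup>*\<rangle>\<close> and the imaginary lines
  \<open>\<langle>p, q\<^sup>*\<rangle>\<close>, \<open>\<langle>q, p\<^sup>*\<rangle>\<close>. Every \<open>\<lambda> A - B\<close> with real \<open>\<lambda>\<close> is a nonsingular symmetric matrix whose
  Hermitian form vanishes on the plane \<open>\<langle>p, p\<^sup>*\<rangle>\<close>, so it can have neither three positive nor three
  negative eigenvalues.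
\<close>

section \<open>Spectral theory of self-adjoint matrices\<close>

lemma jordan_matrix_ones:
  "jordan_matrix (map (Pair 1) ts) = mat (length ts) (length ts) (\<lambda>(i,j). if i = j then ts ! i else 0)"
proof (induction ts)
  case Nil
  show ?case by (rule eq_matI) (auto simp: jordan_matrix_def)
next
  case (Cons t ts)
  have "jordan_matrix (map (Pair 1) (t # ts)) = four_block_mat (jordan_block 1 t)
      (0\<^sub>m 1 (dim_col (jordan_matrix (map (Pair 1) ts)))) (0\<^sub>m (dim_row (jordan_matrix (map (Pair 1) ts))) 1)
      (jordan_matrix (map (Pair 1) ts))"
    by (simp only: jordan_matrix_def diag_block_mat.simps list.map prod.case Let_def
      dim_row_mat dim_col_mat jordan_block_def)
  thus ?case unfolding Cons.IH
    by (intro eq_matI) (auto simp: four_block_mat_def Let_def jordan_block_def nth_Cons')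
qed

lemma mult_mat_vec_zero:
  "M \<in> carrier_mat n m \<Longrightarrow> M *\<^sub>v 0\<^sub>v m = 0\<^sub>v n"
  by (auto intro!: eq_vecI)

text \<open>A similarity to a diagonal \<open>D\<close> says \<open>M * P = P * D\<close>, which
  read column by column makes the columns of \<open>P\<close> eigenvectors. The inverse
  \<open>Q\<close> is kept because \<open>Q *\<^sub>v x\<close> gives the coordinates of
  \<open>x\<close> in this eigenbasis.\<close>

lemma eigenspace_basis:
  fixes M :: "'a :: field mat"
  assumes M: "M \<in> carrier_mat n n" and jnf: "jordan_nf M (map (Pair 1) ts)"
  obtains P Q where "P \<in> carrier_mat n n" "Q \<in> carrier_mat n n" "P * Q = 1\<^sub>m n" "Q * P = 1\<^sub>m n"
    "length ts = n" "\<And>i. i < n \<Longrightarrow> M *\<^sub>v col P i = (ts ! i) \<cdot>\<^sub>v col P i"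
proof -
  define D where "D = jordan_matrix (map (Pair 1) ts)"
  obtain P Q where "similar_mat_wit M D P Q"
    using jnf unfolding jordan_nf_def similar_mat_def D_def by blast
  note w = similar_mat_witD2[OF M this]
  have len: "length ts = n" using w(5) unfolding D_def jordan_matrix_ones by auto
  have D: "D = mat n n (\<lambda>(i,j). if i = j then ts ! i else 0)"
    unfolding D_def jordan_matrix_ones len ..
  have MP: "M * P = P * D"
    by (simp add: w(3) assoc_mult_mat[OF mult_carrier_mat[OF w(6) w(5)] w(7) w(6)]
      w(2) right_mult_one_mat[OF mult_carrier_mat[OF w(6) w(5)]])
  have "M *\<^sub>v col P i = (ts ! i) \<cdot>\<^sub>v col P i" if i: "i < n" for i
  proof -
    have "M *\<^sub>v col P i = col (M * P) i" using M w(6) i by (simp add: col_mult2[OF M w(6) i])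
    also have "\<dots> = P *\<^sub>v col D i" unfolding MP by (rule col_mult2[OF w(6) w(5) i])
    also have "col D i = (ts ! i) \<cdot>\<^sub>v unit_vec n i"
      using i by (intro eq_vecI) (auto simp: D)
    also have "P *\<^sub>v \<dots> = (ts ! i) \<cdot>\<^sub>v col P i"
      using i w(6) by (intro eq_vecI) (auto simp: mult_mat_vec[OF w(6)])
    finally show ?thesis .
  qed
  with w len show ?thesis using that by blast
qed

section \<open>Real eigenvalues and diagonalizability of self-adjoint matrices\<close>

lemma selfadjoint_eigenvalue_real:
  fixes K :: "complex mat"
  assumes K: "K \<in> carrier_mat n n"
    and sa: "\<And>x y. x \<in> carrier_vec n \<Longrightarrow> y \<in> carrier_vec n \<Longrightarrow> (K *\<^sub>v x) \<bullet>c y = x \<bullet>c (K *\<^sub>v y)"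
    and x: "x \<in> carrier_vec n" "x \<noteq> 0\<^sub>v n" and Kx: "K *\<^sub>v x = a \<cdot>\<^sub>v x"
  shows "cnj a = a"
proof -
  have "a * (x \<bullet>c x) = cnj a * (x \<bullet>c x)"
    using sa[OF x(1) x(1)] x(1) by (simp add: Kx conjugate_smult_vec)
  thus ?thesis using x by simp
qed

text \<open>Used with \<open>min 1\<close> and \<open>min 2\<close>, this turns an equality of
  kernel dimensions into a statement about each Jordan block.\<close>

lemma sum_list_eq_pointwise:
  fixes f g :: "'a \<Rightarrow> nat"
  assumes "\<And>x. x \<in> set xs \<Longrightarrow> f x \<le> g x" and "(\<Sum>x\<leftarrow>xs. f x) = (\<Sum>x\<leftarrow>xs. g x)"
  shows "\<forall>x\<in>set xs. f x = g x"
  using assms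
proof (induction xs)
  case (Cons x xs)
  have le: "f x \<le> g x" "(\<Sum>x\<leftarrow>xs. f x) \<le> (\<Sum>x\<leftarrow>xs. g x)"
    using Cons.prems(1) by (auto intro!: sum_list_mono)
  have "f x + (\<Sum>x\<leftarrow>xs. f x) = g x + (\<Sum>x\<leftarrow>xs. g x)"
    using Cons.prems(2) by simp
  hence eq: "f x = g x" "(\<Sum>x\<leftarrow>xs. f x) = (\<Sum>x\<leftarrow>xs. g x)"
    using le by linarith+
  have "\<forall>x\<in>set xs. f x = g x"
    using Cons.prems(1) by (intro Cons.IH eq(2)) simp
  thus ?case using eq(1) by simp
qed simp

text \<open>For self-adjoint \<open>N = K - a\<close>, a vector with \<open>N (N x) = 0\<close>
  satisfies \<open>|N x|^2 = <x, N (N x)> = 0\<close>. Hence \<open>N\<close> and its square have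
  the same kernel, and no Jordan block can be larger than 1.\<close>

lemma selfadjoint_diagonalizable:
  fixes K :: "complex mat"
  assumes K: "K \<in> carrier_mat n n"
    and sa: "\<And>x y. x \<in> carrier_vec n \<Longrightarrow> y \<in> carrier_vec n \<Longrightarrow> (K *\<^sub>v x) \<bullet>c y = x \<bullet>c (K *\<^sub>v y)"
  obtains ts :: "real list" where "jordan_nf K (map (Pair 1) (map complex_of_real ts))"
proof -
  obtain as where "char_poly K = (\<Prod>a\<leftarrow>as. [:- a, 1:])"
    using char_poly_factorized[OF K] by blast
  then obtain nas where jnf: "jordan_nf K nas" using jordan_nf_exists[OF K] by blast
  have real: "cnj a = a" if "(m, a) \<in> set nas" for m a
  proof -
    \<comment> \<open>Blocks of size 0 are excluded by \<open>jordan_nf\<close>, so \<open>a\<close>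
      really is a root of the characteristic polynomial.\<close>
    have "m \<noteq> 0" using jnf that by (force simp: jordan_nf_def)
    hence "poly (char_poly K) a = 0"
      using jordan_nf_char_poly[OF jnf] that by (force simp: poly_prod_list prod_list_zero_iff)
    hence "eigenvalue K a" using eigenvalue_root_char_poly[OF K] by simp
    then obtain x where "x \<in> carrier_vec n" "x \<noteq> 0\<^sub>v n" "K *\<^sub>v x = a \<cdot>\<^sub>v x"
      using K by (auto simp: eigenvalue_def eigenvector_def)
    thus ?thesis using selfadjoint_eigenvalue_real[OF K sa] by blast
  qed
  have one: "m = 1" if mem: "(m, a) \<in> set nas" for m a
  proof -
    define N where "N = char_matrix K a"
    have N: "N \<in> carrier_mat n n" using K by (simp add: N_def)
    have Nx: "N *\<^sub>v x = K *\<^sub>v x + (- a) \<cdot>\<^sub>v x" if "x \<in> carrier_vec n" for x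
      using K that unfolding N_def char_matrix_def
      by (intro eq_vecI) (auto simp: add_scalar_prod_distrib[of _ n])
    \<comment> \<open>The shift by \<open>a\<close> keeps \<open>K\<close> self-adjoint because
      \<open>a\<close> is real.\<close>
    have Nsa: "(N *\<^sub>v x) \<bullet>c y = x \<bullet>c (N *\<^sub>v y)" if "x \<in> carrier_vec n" "y \<in> carrier_vec n" for x y
      using K that real[OF mem]
      by (simp add: Nx conjugate_add_vec[of _ n] conjugate_smult_vec add_scalar_prod_distrib[of _ n]
        scalar_prod_add_distrib[of _ n] sa conjugate_complex_def)
    have ker: "mat_kernel (N ^\<^sub>m 2) = mat_kernel (N ^\<^sub>m 1)"
    proof -
      have N1: "N ^\<^sub>m 1 = N" using N by simp
      have N2: "N ^\<^sub>m 2 = N * N" using N by (simp add: numeral_2_eq_2)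
      have "N *\<^sub>v x = 0\<^sub>v n" if x: "x \<in> carrier_vec n" and "N * N *\<^sub>v x = 0\<^sub>v n" for x
      proof -
        have "(N *\<^sub>v x) \<bullet>c (N *\<^sub>v x) = x \<bullet>c (N * N *\<^sub>v x)"
          using Nsa[OF x, of "N *\<^sub>v x"] N x by simp
        also have "\<dots> = 0" using that by simp
        finally show ?thesis
          using conjugate_square_eq_0_vec[OF mult_mat_vec_carrier[OF N x]] by blast
      qed
      moreover have "N * N *\<^sub>v x = 0\<^sub>v n" if "x \<in> carrier_vec n" "N *\<^sub>v x = 0\<^sub>v n" for x
        using N that by (simp add: mult_mat_vec_zero)
      ultimately show ?thesis unfolding N1 N2 mat_kernel_def
        using N by (auto simp del: assoc_mult_mat_vec)
    qed
    \<comment> \<open>The kernel dimension of the \<open>k\<close>-th power of \<open>N\<close> is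
      the sum of \<open>min k m\<close> over the sizes \<open>m\<close> of the blocks to
      \<open>a\<close>. Equality for \<open>k = 1\<close> and \<open>k = 2\<close> therefore bounds
      every size by 1.\<close>
    have "dim_gen_eigenspace K a 2 = dim_gen_eigenspace K a 1"
      using N ker unfolding dim_gen_eigenspace_def N_def[symmetric] kernel_dim_def by simp
    hence eq: "(\<Sum>k\<leftarrow>map fst [(k, e)\<leftarrow>nas. e = a]. min 2 k) = (\<Sum>k\<leftarrow>map fst [(k, e)\<leftarrow>nas. e = a]. min 1 k)"
      unfolding dim_gen_eigenspace[OF jnf] .
    have "\<forall>k\<in>set (map fst [(k, e)\<leftarrow>nas. e = a]). min 1 k = min 2 k"
      using sum_list_eq_pointwise[where f = "min 1" and g = "min 2", OF _ eq[symmetric]] by simp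
    moreover have "m \<in> set (map fst [(k, e)\<leftarrow>nas. e = a])"
      using mem by force
    ultimately have "min 1 m = min 2 m" by blast
    moreover have "m \<noteq> 0" using jnf mem by (force simp: jordan_nf_def)
    ultimately show ?thesis by simp
  qed
  have "nas = map (Pair 1) (map complex_of_real (map (Re \<circ> snd) nas))"
  proof (rule nth_equalityI)
    fix i assume "i < length nas"
    moreover obtain m a where "nas ! i = (m, a)" by fastforce
    moreover from calculation have "(m, a) \<in> set nas" by (metis nth_mem)
    ultimately show "nas ! i = map (Pair 1) (map complex_of_real (map (Re \<circ> snd) nas)) ! i"
      using real one by (auto simp: complex_eq_iff)
  qed simp
  with jnf that show ?thesis by metis
qed

lemma conj_mult_mat_vec_cmat:
  assumes "M \<in> carrier_mat n n" "x \<in> carrier_vec n"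
  shows "conjugate (cmat M *\<^sub>v x) = cmat M *\<^sub>v conjugate x"
  using assms by (intro eq_vecI) (auto simp: cmat_def scalar_prod_def conjugate_complex_def)

text \<open>A real matrix commutes with conjugation, so symmetry for the bilinear product becomes
  self-adjointness for the Hermitian one.\<close>

lemma selfadjoint_cmat:
  assumes K: "K \<in> carrier_mat n n" and sym: "K\<^sup>T = K"
    and x: "x \<in> carrier_vec n" and y: "y \<in> carrier_vec n"
  shows "(cmat K *\<^sub>v x) \<bullet>c y = x \<bullet>c (cmat K *\<^sub>v y)"
proof -
  have cK: "cmat K \<in> carrier_mat n n" using K by (simp add: cmat_def)
  have "(cmat K)\<^sup>T = cmat K" using sym by (simp add: cmat_def map_mat_transpose)
  thus ?thesis
    using transpose_vec_mult_scalar[OF cK x, of "conjugate y"] x y cK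
    by (simp add: conj_mult_mat_vec_cmat[OF K] comm_scalar_prod[of _ n])
qed

section \<open>Positive eigenvalues and isotropic planes\<close>

lemma order_prod_linear_factors:
  "Polynomial.order (x::real) (\<Prod>t\<leftarrow>ts. [:- t, 1:]) = count_list ts x"
proof (induction ts)
  case (Cons t ts)
  have "(\<Prod>t\<leftarrow>(t#ts). [:- t, 1:]) \<noteq> (0 :: real poly)" by (simp add: prod_list_zero_iff del: prod_list.Cons) auto
  hence "Polynomial.order x (\<Prod>t\<leftarrow>(t#ts). [:- t, 1:]) = Polynomial.order x [:- t, 1:] + Polynomial.order x (\<Prod>t\<leftarrow>ts. [:- t, 1:])"
    unfolding list.map prod_list.Cons by (rule order_mult)
  moreover have "Polynomial.order x [:- t, 1:] = (if x = t then 1 else 0)"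
    using order_power_n_n[of t 1] by (auto simp: order_0I)
  ultimately show ?case using Cons.IH by simp
qed simp

text \<open>The complex Jordan form factors the characteristic polynomial over real roots, and
  injectivity of the embedding of the reals carries the factorization back. Orders of roots then
  become multiplicities in \<open>ts\<close>.\<close>

lemma num_pos_eig_jordan_nf:
  assumes K: "K \<in> carrier_mat n n" and jnf: "jordan_nf (cmat K) (map (Pair 1) (map complex_of_real ts))"
  shows "num_pos_eig K = length (filter (\<lambda>t. t > 0) ts)"
proof -
  interpret R: map_poly_inj_idom_hom complex_of_real ..
  have "map_poly complex_of_real (char_poly K) = char_poly (cmat K)"
    unfolding cmat_def by (rule of_real_hom.char_poly_hom[OF K, symmetric])
  also have "\<dots> = (\<Prod>t\<leftarrow>ts. [:- complex_of_real t, 1:])"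
    using jordan_nf_char_poly[OF jnf] by (simp add: comp_def)
  also have "\<dots> = map_poly complex_of_real (\<Prod>t\<leftarrow>ts. [:- t, 1:])"
    by (simp add: R.hom_prod_list comp_def)
  finally have cp: "char_poly K = (\<Prod>t\<leftarrow>ts. [:- t, 1:])" by (rule R.injectivity)
  have "{x. x > 0 \<and> poly (char_poly K) x = 0} = set (filter (\<lambda>t. t > 0) ts)"
    by (auto simp: cp poly_prod_list prod_list_zero_iff)
  moreover have "Polynomial.order x (char_poly K) = count_list (filter (\<lambda>t. t > 0) ts) x" if "x > 0" for x
    using that unfolding cp order_prod_linear_factors by (induction ts) auto
  ultimately show ?thesis
    unfolding num_pos_eig_def by (simp add: sum_count_set)
qed

text \<open>Expansion through the Gram matrix of the columns of \<open>P\<close>, which need not be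
  orthonormal.\<close>

lemma mult_mat_vec_cscalar_prod:
  fixes P :: "complex mat"
  assumes P: "P \<in> carrier_mat n m" and z: "z \<in> carrier_vec m" and w: "w \<in> carrier_vec m"
  shows "(P *\<^sub>v z) \<bullet>c (P *\<^sub>v w) = (\<Sum>i<m. \<Sum>j<m. z $ i * cnj (w $ j) * (col P i \<bullet>c col P j))"
proof -
  have "(P *\<^sub>v z) \<bullet>c (P *\<^sub>v w) = (\<Sum>r<n. \<Sum>i<m. \<Sum>j<m. (z $ i * cnj (w $ j)) * (P $$ (r, i) * cnj (P $$ (r, j))))"
    using P z w
    by (simp add: scalar_prod_def conjugate_complex_def atLeast0LessThan sum_product cnj_sum mult_ac)
  also have "\<dots> = (\<Sum>i<m. \<Sum>r<n. \<Sum>j<m. (z $ i * cnj (w $ j)) * (P $$ (r, i) * cnj (P $$ (r, j))))"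
    by (rule sum.swap)
  also have "\<dots> = (\<Sum>i<m. \<Sum>j<m. \<Sum>r<n. (z $ i * cnj (w $ j)) * (P $$ (r, i) * cnj (P $$ (r, j))))"
    by (intro sum.cong refl sum.swap)
  also have "\<dots> = (\<Sum>i<m. \<Sum>j<m. z $ i * cnj (w $ j) * (col P i \<bullet>c col P j))"
    using P by (simp add: scalar_prod_def conjugate_complex_def atLeast0LessThan sum_distrib_left)
  finally show ?thesis .
qed

text \<open>Rescaling the eigencoordinates of \<open>x\<close> by \<open>sqrt (\<sigma> t\<^sub>i)\<close> turns the form of \<open>\<sigma> K\<close> into a
  Euclidean norm; no orthonormal eigenbasis is needed because eigenvectors to different
  eigenvalues are orthogonal.\<close>

lemma definite_on_signed_eigenspaces:
  fixes K P Q :: "complex mat" and ts :: "real list" and \<sigma> :: real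
  assumes K: "K \<in> carrier_mat n n"
    and sa: "\<And>x y. x \<in> carrier_vec n \<Longrightarrow> y \<in> carrier_vec n \<Longrightarrow> (K *\<^sub>v x) \<bullet>c y = x \<bullet>c (K *\<^sub>v y)"
    and P: "P \<in> carrier_mat n n" and Q: "Q \<in> carrier_mat n n" and PQ: "P * Q = 1\<^sub>m n" "Q * P = 1\<^sub>m n"
    and ev: "\<And>i. i < n \<Longrightarrow> K *\<^sub>v col P i = complex_of_real (ts ! i) \<cdot>\<^sub>v col P i"
    and x: "x \<in> carrier_vec n" and iso: "(K *\<^sub>v x) \<bullet>c x = 0"
    and supp: "\<And>i. i < n \<Longrightarrow> (Q *\<^sub>v x) $ i \<noteq> 0 \<Longrightarrow> \<sigma> * ts ! i > 0"
  shows "x = 0\<^sub>v n"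
proof -
  define y where "y = Q *\<^sub>v x"
  have y: "y \<in> carrier_vec n" using Q x by (simp add: y_def)
  have xy: "x = P *\<^sub>v y"
    using P Q x PQ by (simp add: y_def assoc_mult_mat_vec[symmetric])
  define T where "T = mat n n (\<lambda>(i,j). if i = j then complex_of_real (ts ! i) else 0)"
  have T: "T \<in> carrier_mat n n" by (simp add: T_def)
  have KP: "K * P = P * T"
  proof (rule mat_col_eqI)
    fix i assume "i < dim_col (P * T)"
    hence i: "i < n" by (simp add: T_def)
    have "col T i = complex_of_real (ts ! i) \<cdot>\<^sub>v unit_vec n i"
      using i by (intro eq_vecI) (auto simp: T_def)
    thus "col (K * P) i = col (P * T) i"
      using i P by (intro eq_vecI) (auto simp: col_mult2[OF K P i] col_mult2[OF P T i] ev mult_mat_vec[OF P])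
  qed (use K P in \<open>auto simp: T_def\<close>)
  define u where "u = vec n (\<lambda>i. complex_of_real (ts ! i) * y $ i)"
  have "T *\<^sub>v y = u"
    using y by (intro eq_vecI) (auto simp: u_def T_def scalar_prod_def if_distrib[of "\<lambda>c. c * _"] cong: if_cong)
  hence Kx: "K *\<^sub>v x = P *\<^sub>v u"
    using xy y K P T KP by (metis assoc_mult_mat_vec)
  define z where "z = vec n (\<lambda>i. complex_of_real (sqrt (\<sigma> * ts ! i)) * y $ i)"
  have z: "z \<in> carrier_vec n" and u: "u \<in> carrier_vec n" by (simp_all add: z_def u_def)
  have orth: "col P i \<bullet>c col P j = 0" if ij: "i < n" "j < n" and ne: "ts ! i \<noteq> ts ! j" for i j
  proof -
    have "col P i \<in> carrier_vec n" "col P j \<in> carrier_vec n" using P ij by auto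
    hence "complex_of_real (ts ! i) * (col P i \<bullet>c col P j) = complex_of_real (ts ! j) * (col P i \<bullet>c col P j)"
      using sa[of "col P i" "col P j"] by (simp add: ev[OF ij(1)] ev[OF ij(2)] conjugate_smult_vec)
    thus ?thesis using ne by simp
  qed
  \<comment> \<open>If the two eigenvalues agree and \<open>y $ i\<close> is nonzero, the product of
    the two equal square roots is \<open>\<sigma> * ts ! i\<close>. Otherwise the Gram entry or the
    coordinate vanishes, and both sides are 0.\<close>
  have rescale: "z $ i * cnj (z $ j) * (col P i \<bullet>c col P j) = \<sigma> * (u $ i * cnj (y $ j) * (col P i \<bullet>c col P j))"
    if ij: "i < n" "j < n" for i j
  proof (cases "ts ! i = ts ! j \<and> y $ i \<noteq> 0")
    case True
    hence "\<sigma> * ts ! i > 0" using supp[OF ij(1)] by (simp add: y_def)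
    hence "complex_of_real (sqrt (\<sigma> * ts ! i)) * complex_of_real (sqrt (\<sigma> * ts ! i)) = \<sigma> * ts ! i"
      by (simp flip: of_real_mult)
    thus ?thesis using True ij by (simp add: z_def u_def algebra_simps)
  next
    case False
    thus ?thesis using orth[OF ij] ij by (auto simp: z_def u_def)
  qed
  \<comment> \<open>The squared norm of \<open>P *\<^sub>v z\<close> is \<sigma> times the Hermitian
    form of \<open>K\<close> at \<open>x\<close>, which is 0 by \<open>iso\<close>.\<close>
  have "(P *\<^sub>v z) \<bullet>c (P *\<^sub>v z) = \<sigma> * ((P *\<^sub>v u) \<bullet>c (P *\<^sub>v y))"
    unfolding mult_mat_vec_cscalar_prod[OF P z z] mult_mat_vec_cscalar_prod[OF P u y] sum_distrib_left
    by (intro sum.cong refl rescale) auto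
  moreover have "(P *\<^sub>v u) \<bullet>c (P *\<^sub>v y) = 0" using iso Kx xy by simp
  ultimately have "P *\<^sub>v z = 0\<^sub>v n"
    using conjugate_square_eq_0_vec[OF mult_mat_vec_carrier[OF P z]] by simp
  moreover have "Q *\<^sub>v (P *\<^sub>v z) = z"
    using P Q z PQ by (simp add: assoc_mult_mat_vec[symmetric])
  ultimately have z0: "z = 0\<^sub>v n" using Q by (simp add: mult_mat_vec_zero)
  have "y = 0\<^sub>v n"
  proof (rule eq_vecI)
    fix i assume "i < dim_vec (0\<^sub>v n :: complex vec)"
    hence i: "i < n" by simp
    have "y $ i = 0"
    proof (rule ccontr)
      assume "y $ i \<noteq> 0"
      moreover from this have "\<sigma> * ts ! i > 0" using supp[OF i] by (simp add: y_def)
      ultimately have "z $ i \<noteq> 0" using i by (auto simp: z_def)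
      thus False using i unfolding z0 by simp
    qed
    thus "y $ i = 0\<^sub>v n $ i" using i by simp
  qed (use y in simp)
  thus ?thesis using xy P by (simp add: mult_mat_vec_zero)
qed

text \<open>If three eigenvalues had the same sign, some nonzero vector of the plane would have
  vanishing fourth eigencoordinate, and the form would be definite there, against isotropy. Since no
  eigenvalue is 0, the signs must split two and two.\<close>

lemma num_pos_eig_isotropic_plane:
  assumes K: "K \<in> carrier_mat 4 4" and sym: "K\<^sup>T = K"
    and inj: "\<And>x. x \<in> carrier_vec 4 \<Longrightarrow> cmat K *\<^sub>v x = 0\<^sub>v 4 \<Longrightarrow> x = 0\<^sub>v 4"
    and u: "u \<in> carrier_vec 4" and v: "v \<in> carrier_vec 4"
    and indep: "\<And>a b. a \<cdot>\<^sub>v u + b \<cdot>\<^sub>v v = 0\<^sub>v 4 \<Longrightarrow> a = 0 \<and> b = 0"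
    and iso: "\<And>a b. (cmat K *\<^sub>v (a \<cdot>\<^sub>v u + b \<cdot>\<^sub>v v)) \<bullet>c (a \<cdot>\<^sub>v u + b \<cdot>\<^sub>v v) = 0"
  shows "num_pos_eig K = 2"
proof -
  have cK: "cmat K \<in> carrier_mat 4 4" using K by (simp add: cmat_def)
  note sa = selfadjoint_cmat[OF K sym]
  obtain ts :: "real list" where jnf: "jordan_nf (cmat K) (map (Pair 1) (map complex_of_real ts))"
    using selfadjoint_diagonalizable[OF cK sa] by blast
  obtain P Q where P: "P \<in> carrier_mat 4 4" and Q: "Q \<in> carrier_mat 4 4"
    and PQ: "P * Q = 1\<^sub>m 4" "Q * P = 1\<^sub>m 4" and len: "length ts = 4"
    and ev': "\<And>i. i < 4 \<Longrightarrow> cmat K *\<^sub>v col P i = map complex_of_real ts ! i \<cdot>\<^sub>v col P i"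
    using eigenspace_basis[OF cK jnf] by (metis length_map)
  have ev: "cmat K *\<^sub>v col P i = complex_of_real (ts ! i) \<cdot>\<^sub>v col P i" if "i < 4" for i
    using ev'[OF that] that len by simp
  have nz: "ts ! i \<noteq> 0" if i: "i < 4" for i
  proof
    assume "ts ! i = 0"
    hence "cmat K *\<^sub>v col P i = 0\<^sub>v 4" using ev[OF i] P i by (auto intro!: eq_vecI)
    hence "col P i = 0\<^sub>v 4" using inj[of "col P i"] P i by auto
    moreover have "Q *\<^sub>v col P i = col (1\<^sub>m 4) i" using col_mult2[OF Q P i] PQ by simp
    ultimately have "unit_vec 4 i = (0\<^sub>v 4 :: complex vec)" using i Q by (simp add: mult_mat_vec_zero)
    thus False using i by (metis index_unit_vec(1) index_zero_vec(1) zero_neq_one)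
  qed
  text \<open>A plane meets every hyperplane of eigencoordinates.\<close>
  have two: "\<exists>i\<in>{0,1,2,3}. i \<noteq> k \<and> \<not> \<sigma> * ts ! i > 0" if k: "k < 4" for k \<sigma>
  proof (rule ccontr)
    assume "\<not> ?thesis"
    hence pos: "\<sigma> * ts ! i > 0" if "i < 4" "i \<noteq> k" for i
      using that by (auto simp: numeral_eq_Suc less_Suc_eq)
    define a where "a = (Q *\<^sub>v u) $ k"
    define b where "b = (Q *\<^sub>v v) $ k"
    \<comment> \<open>The pair \<open>(s, t)\<close> is a nonzero solution of
      \<open>s * a + t * b = 0\<close>: it is \<open>(1, 0)\<close> if \<open>a = 0\<close> and
      \<open>(b, - a)\<close> otherwise.\<close>
    define s where "s = (if a = 0 then 1 else b)"
    define t where "t = (if a = 0 then 0 else - a)"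
    let ?x = "s \<cdot>\<^sub>v u + t \<cdot>\<^sub>v v"
    have "(Q *\<^sub>v ?x) $ k = s * a + t * b"
      using Q u v k by (simp add: mult_add_distrib_mat_vec[OF Q] mult_mat_vec[OF Q] a_def b_def)
    hence "(Q *\<^sub>v ?x) $ k = 0" by (simp add: s_def t_def)
    hence supp: "\<sigma> * ts ! i > 0" if "i < 4" "(Q *\<^sub>v ?x) $ i \<noteq> 0" for i
      using pos that by (cases "i = k") auto
    have x: "?x \<in> carrier_vec 4" using u v by simp
    have "?x = 0\<^sub>v 4"
      by (rule definite_on_signed_eigenspaces[OF cK sa P Q PQ ev x iso supp]) assumption+
    hence "s = 0 \<and> t = 0" by (rule indep)
    thus False by (auto simp: s_def t_def split: if_splits)
  qed
  obtain a b c d where ts: "ts = [a, b, c, d]"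
    using len by (auto simp: eval_nat_numeral length_Suc_conv)
  \<comment> \<open>Here \<open>\<sigma> = 1\<close> excludes three positive eigenvalues and, below,
    \<open>\<sigma> = -1\<close> three negative ones; \<open>k\<close> is the index left
    out.\<close>
  have not_pos: "\<not> (b > 0 \<and> c > 0 \<and> d > 0)" "\<not> (a > 0 \<and> c > 0 \<and> d > 0)"
    "\<not> (a > 0 \<and> b > 0 \<and> d > 0)" "\<not> (a > 0 \<and> b > 0 \<and> c > 0)"
    using two[of 0 1] two[of 1 1] two[of 2 1] two[of 3 1] by (simp_all add: ts)
  have not_neg: "\<not> (b < 0 \<and> c < 0 \<and> d < 0)" "\<not> (a < 0 \<and> c < 0 \<and> d < 0)"
    "\<not> (a < 0 \<and> b < 0 \<and> d < 0)" "\<not> (a < 0 \<and> b < 0 \<and> c < 0)"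
    using two[of 0 "-1"] two[of 1 "-1"] two[of 2 "-1"] two[of 3 "-1"] by (simp_all add: ts)
  have "a > 0 \<or> a < 0" "b > 0 \<or> b < 0" "c > 0 \<or> c < 0" "d > 0 \<or> d < 0"
    using nz[of 0] nz[of 1] nz[of 2] nz[of 3] by (auto simp: ts)
  hence "length (filter (\<lambda>t. t > 0) ts) = 2"
    using not_pos not_neg unfolding ts by (elim disjE) simp_all
  thus ?thesis using num_pos_eig_jordan_nf[OF K jnf] by simp
qed

section \<open>Symmetric pencils with a nonreal eigenvalue\<close>

text \<open>Complex bilinear, without conjugation, as in the equations of the quadrics. The
  Hermitian form arises by conjugating one argument.\<close>

definition bform :: "complex mat \<Rightarrow> complex vec \<Rightarrow> complex vec \<Rightarrow> complex" where
  "bform M x y = x \<bullet> (M *\<^sub>v y)"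

context
  fixes M :: "complex mat" and n :: nat
  assumes M: "M \<in> carrier_mat n n"
begin

lemma bform_add_left:
  "x \<in> carrier_vec n \<Longrightarrow> y \<in> carrier_vec n \<Longrightarrow> z \<in> carrier_vec n \<Longrightarrow>
    bform M (x + y) z = bform M x z + bform M y z"
  using M by (simp add: bform_def add_scalar_prod_distrib[of _ n])

lemma bform_add_right:
  "x \<in> carrier_vec n \<Longrightarrow> y \<in> carrier_vec n \<Longrightarrow> z \<in> carrier_vec n \<Longrightarrow>
    bform M x (y + z) = bform M x y + bform M x z"
  using M by (simp add: bform_def mult_add_distrib_mat_vec[OF M] scalar_prod_add_distrib[of _ n])

lemma bform_smult_left:
  "x \<in> carrier_vec n \<Longrightarrow> y \<in> carrier_vec n \<Longrightarrow> bform M (a \<cdot>\<^sub>v x) y = a * bform M x y"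
  using M by (simp add: bform_def)

lemma bform_smult_right:
  "x \<in> carrier_vec n \<Longrightarrow> y \<in> carrier_vec n \<Longrightarrow> bform M x (a \<cdot>\<^sub>v y) = a * bform M x y"
  using M by (simp add: bform_def mult_mat_vec[OF M])

lemma bform_sym:
  "M\<^sup>T = M \<Longrightarrow> x \<in> carrier_vec n \<Longrightarrow> y \<in> carrier_vec n \<Longrightarrow> bform M x y = bform M y x"
  using transpose_vec_mult_scalar[OF M, of y x] M
  by (simp add: bform_def comm_scalar_prod[of _ n])

lemmas bform_linear = bform_add_left bform_add_right bform_smult_left bform_smult_right

text \<open>Unit vectors as left argument read off the entries of
  \<open>M *\<^sub>v y\<close>.\<close>

lemma bform_nondegenerate:
  assumes y: "y \<in> carrier_vec n" and "\<And>x. x \<in> carrier_vec n \<Longrightarrow> bform M x y = 0"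
  shows "M *\<^sub>v y = 0\<^sub>v n"
proof (rule eq_vecI)
  fix i assume "i < dim_vec (0\<^sub>v n :: complex vec)"
  thus "(M *\<^sub>v y) $ i = 0\<^sub>v n $ i"
    using assms(2)[of "unit_vec n i"] M y by (simp add: bform_def)
qed (use M in simp)

end

lemma bform_conjugate:
  assumes "M \<in> carrier_mat n n" "x \<in> carrier_vec n" "y \<in> carrier_vec n"
  shows "bform (cmat M) (conjugate x) (conjugate y) = cnj (bform (cmat M) x y)"
proof -
  have "cmat M *\<^sub>v y \<in> carrier_vec n" using assms by (simp add: cmat_def)
  thus ?thesis
    using conjugate_sprod_vec[of x n "cmat M *\<^sub>v y"] assms
    by (simp add: bform_def conj_mult_mat_vec_cmat conjugate_complex_def)
qed

section \<open>Eigenspaces of the pencil and the splitting into conjugate planes\<close>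

definition indep2 :: "complex vec \<Rightarrow> complex vec \<Rightarrow> bool" where
  "indep2 u v \<longleftrightarrow> (\<forall>a b. a \<cdot>\<^sub>v u + b \<cdot>\<^sub>v v = 0\<^sub>v 4 \<longrightarrow> a = 0 \<and> b = 0)"

definition pencil_eigen :: "real mat \<Rightarrow> real mat \<Rightarrow> complex \<Rightarrow> complex vec \<Rightarrow> bool" where
  "pencil_eigen A B \<alpha> e \<longleftrightarrow> e \<in> carrier_vec 4 \<and> cmat B *\<^sub>v e = \<alpha> \<cdot>\<^sub>v (cmat A *\<^sub>v e)"

text \<open>Coordinates in the frame formed by \<open>p\<close>, \<open>q\<close> and their
  conjugates. The grouping separates the component in the eigenspace of \<alpha> from that in the
  conjugate eigenspace.\<close>

definition comb4 :: "complex vec \<Rightarrow> complex vec \<Rightarrow> complex \<Rightarrow> complex \<Rightarrow> complex \<Rightarrow> complex \<Rightarrow> complex vec" where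
  "comb4 p q a b c d = (a \<cdot>\<^sub>v p + b \<cdot>\<^sub>v q) + (c \<cdot>\<^sub>v conjugate p + d \<cdot>\<^sub>v conjugate q)"

locale symmetric_pencil =
  fixes A B :: "real mat" and \<alpha> :: complex
  assumes A: "A \<in> carrier_mat 4 4" and B: "B \<in> carrier_mat 4 4"
    and symA: "A\<^sup>T = A" and symB: "B\<^sup>T = B"
    and injA: "\<And>x. x \<in> carrier_vec 4 \<Longrightarrow> cmat A *\<^sub>v x = 0\<^sub>v 4 \<Longrightarrow> x = 0\<^sub>v 4"
    and nonreal: "\<alpha> \<noteq> cnj \<alpha>"
begin

lemma cA: "cmat A \<in> carrier_mat 4 4" and cB: "cmat B \<in> carrier_mat 4 4"
  using A B by (auto simp: cmat_def)

lemma symcA: "(cmat A)\<^sup>T = cmat A" and symcB: "(cmat B)\<^sup>T = cmat B"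
  using symA symB by (simp_all add: cmat_def map_mat_transpose)

lemma eigen_carrier: "pencil_eigen A B \<beta> e \<Longrightarrow> e \<in> carrier_vec 4"
  by (simp add: pencil_eigen_def)

lemma eigen_comb:
  assumes "pencil_eigen A B \<beta> e" "pencil_eigen A B \<beta> f"
  shows "pencil_eigen A B \<beta> (a \<cdot>\<^sub>v e + b \<cdot>\<^sub>v f)"
  using assms cA cB
  by (auto simp: pencil_eigen_def mult_add_distrib_mat_vec[OF cA] mult_add_distrib_mat_vec[OF cB]
      mult_mat_vec[OF cA] mult_mat_vec[OF cB] smult_add_distrib_vec[of _ 4] smult_smult_assoc mult_ac)

lemma eigen_conjugate:
  assumes "pencil_eigen A B \<beta> e"
  shows "pencil_eigen A B (cnj \<beta>) (conjugate e)"
  using assms conj_mult_mat_vec_cmat[OF A, of e] conj_mult_mat_vec_cmat[OF B, of e]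
  by (auto simp: pencil_eigen_def conjugate_smult_vec conjugate_complex_def)

lemma bform_eigen:
  assumes "x \<in> carrier_vec 4" "pencil_eigen A B \<beta> e"
  shows "bform (cmat B) x e = \<beta> * bform (cmat A) x e"
  using assms cA by (simp add: pencil_eigen_def bform_def)

text \<open>By symmetry the form of \<open>B\<close> at \<open>(e, f)\<close> is both \<beta> times
  and \<gamma> times the form of \<open>A\<close> there.\<close>

lemma bform_eigen_orthogonal:
  assumes e: "pencil_eigen A B \<beta> e" and f: "pencil_eigen A B \<gamma> f" and ne: "\<beta> \<noteq> \<gamma>"
  shows "bform (cmat A) e f = 0"
proof -
  note carr = eigen_carrier[OF e] eigen_carrier[OF f]
  have "\<gamma> * bform (cmat A) e f = \<beta> * bform (cmat A) e f"
    using bform_eigen[OF carr(1) f] bform_eigen[OF carr(2) e]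
      bform_sym[OF cA symcA carr] bform_sym[OF cB symcB carr] by auto
  thus ?thesis using ne by simp
qed

text \<open>Applying \<open>A\<close> and \<open>B\<close> to \<open>u + v = 0\<close> gives two
  linear equations for \<open>A u\<close> and \<open>A v\<close> with determinant
  \<open>\<gamma> - \<beta>\<close>. Hence \<open>A u = 0\<close>, and \<open>A\<close> is
  injective.\<close>

lemma eigen_sum_zero:
  assumes u: "pencil_eigen A B \<beta> u" and v: "pencil_eigen A B \<gamma> v" and ne: "\<beta> \<noteq> \<gamma>"
    and "u + v = 0\<^sub>v 4"
  shows "u = 0\<^sub>v 4" "v = 0\<^sub>v 4"
proof -
  note carr = eigen_carrier[OF u] eigen_carrier[OF v]
  have sum: "cmat A *\<^sub>v u + cmat A *\<^sub>v v = 0\<^sub>v 4" "\<beta> \<cdot>\<^sub>v (cmat A *\<^sub>v u) + \<gamma> \<cdot>\<^sub>v (cmat A *\<^sub>v v) = 0\<^sub>v 4"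
    using assms(4) u v mult_add_distrib_mat_vec[OF cA carr] mult_add_distrib_mat_vec[OF cB carr]
      mult_mat_vec_zero[OF cA] mult_mat_vec_zero[OF cB] by (simp_all add: pencil_eigen_def)
  have "(cmat A *\<^sub>v u) $ i = 0" if i: "i < 4" for i
  proof -
    have "(cmat A *\<^sub>v u) $ i + (cmat A *\<^sub>v v) $ i = 0"
      "\<beta> * (cmat A *\<^sub>v u) $ i + \<gamma> * (cmat A *\<^sub>v v) $ i = 0"
      using arg_cong[OF sum(1), of "\<lambda>x. x $ i"] arg_cong[OF sum(2), of "\<lambda>x. x $ i"] i cA by simp_all
    moreover from this(1) have "(cmat A *\<^sub>v v) $ i = - (cmat A *\<^sub>v u) $ i"
      by (simp add: eq_neg_iff_add_eq_0 add.commute)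
    ultimately have "(\<beta> - \<gamma>) * (cmat A *\<^sub>v u) $ i = 0" by (simp add: left_diff_distrib)
    thus ?thesis using ne by simp
  qed
  hence "cmat A *\<^sub>v u = 0\<^sub>v 4" using cA by (intro eq_vecI) auto
  thus u0: "u = 0\<^sub>v 4" using injA carr by blast
  show "v = 0\<^sub>v 4" using assms(4) carr by (simp add: u0)
qed

context
  fixes p q
  assumes p: "pencil_eigen A B \<alpha> p" and q: "pencil_eigen A B \<alpha> q" and indep: "indep2 p q"
begin

lemma pq_carrier: "p \<in> carrier_vec 4" "q \<in> carrier_vec 4"
  using p q by (auto simp: eigen_carrier)

text \<open>Eigenspaces to different eigenvalues are independent, so both halves vanish; conjugating
  the second half turns it into another relation between \<open>p\<close> and
  \<open>q\<close>.\<close>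

lemma comb4_zero:
  assumes "comb4 p q a b c d = 0\<^sub>v 4"
  shows "a = 0 \<and> b = 0 \<and> c = 0 \<and> d = 0"
proof -
  have "pencil_eigen A B \<alpha> (a \<cdot>\<^sub>v p + b \<cdot>\<^sub>v q)"
    "pencil_eigen A B (cnj \<alpha>) (c \<cdot>\<^sub>v conjugate p + d \<cdot>\<^sub>v conjugate q)"
    using p q by (auto intro!: eigen_comb eigen_conjugate)
  note zero = eigen_sum_zero[OF this nonreal assms[unfolded comb4_def]]
  have "cnj c \<cdot>\<^sub>v p + cnj d \<cdot>\<^sub>v q = conjugate (c \<cdot>\<^sub>v conjugate p + d \<cdot>\<^sub>v conjugate q)"
    using pq_carrier by (simp add: conjugate_add_vec[of _ 4] conjugate_smult_vec conjugate_complex_def)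
  also have "\<dots> = 0\<^sub>v 4" using zero(2) by simp
  finally show ?thesis 
    using zero(1) indep complex_cnj_zero_iff unfolding indep2_def by blast
qed

text \<open>The matrix with the four frame vectors as columns has trivial kernel by
  \<open>comb4_zero\<close>, so it is invertible.\<close>

lemma comb4_span:
  assumes x: "x \<in> carrier_vec 4"
  obtains a b c d where "x = comb4 p q a b c d"
proof -
  define P where "P = mat 4 4 (\<lambda>(i,j). [p, q, conjugate p, conjugate q] ! j $ i)"
  have P: "P \<in> carrier_mat 4 4" by (simp add: P_def)
  have Py: "P *\<^sub>v y = comb4 p q (y $ 0) (y $ 1) (y $ 2) (y $ 3)" if "y \<in> carrier_vec 4" for y
    using that pq_carrier
    by (intro eq_vecI) (auto simp: P_def comb4_def scalar_prod_def numeral_eq_Suc)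
  have "det P \<noteq> 0"
  proof
    assume "det P = 0"
    then obtain y where y: "y \<in> carrier_vec 4" "y \<noteq> 0\<^sub>v 4" "P *\<^sub>v y = 0\<^sub>v 4"
      using det_0_iff_vec_prod_zero[OF P] by blast
    hence "y $ 0 = 0 \<and> y $ 1 = 0 \<and> y $ 2 = 0 \<and> y $ 3 = 0" using comb4_zero Py by metis
    hence "y = 0\<^sub>v 4" using y(1)
      by (intro eq_vecI) (auto simp: numeral_eq_Suc less_Suc_eq)
    thus False using y(2) by simp
  qed
  then obtain R where R: "R \<in> carrier_mat 4 4" "P * R = 1\<^sub>m 4"
    using det_non_zero_imp_unit[OF P, of "()"] by (auto simp: Units_def ring_mat_def)
  hence "x = P *\<^sub>v (R *\<^sub>v x)" using P x by (simp flip: assoc_mult_mat_vec)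
  thus ?thesis using that Py[of "R *\<^sub>v x"] R x by auto
qed

section \<open>Isotropic bases of the eigenspace\<close>

text \<open>Otherwise \<open>p\<close> would be orthogonal to all four frame vectors, hence to the
  whole space, and \<open>A p = 0\<close> would follow.\<close>

lemma bform_pq_nonzero:
  assumes "bform (cmat A) p p = 0"
  shows "bform (cmat A) p q \<noteq> 0"
proof
  assume pq: "bform (cmat A) p q = 0"
  note carr = pq_carrier
  have "bform (cmat A) (conjugate p) p = 0" "bform (cmat A) (conjugate q) p = 0"
    using bform_eigen_orthogonal eigen_conjugate p q nonreal by metis+
  moreover have "bform (cmat A) q p = 0" using pq bform_sym[OF cA symcA carr] by simp
  ultimately have "bform (cmat A) x p = 0" if x: "x \<in> carrier_vec 4" for x
    using assms carr by (rule_tac comb4_span[OF x]) (simp add: comb4_def bform_linear[OF cA])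
  hence "p = 0\<^sub>v 4" using bform_nondegenerate[OF cA] injA carr by blast
  hence "1 \<cdot>\<^sub>v p + 0 \<cdot>\<^sub>v q = 0\<^sub>v 4" using carr by (auto intro!: eq_vecI)
  hence "(1 :: complex) = 0 \<and> (0 :: complex) = 0" using indep unfolding indep2_def by blast
  thus False by simp
qed

text \<open>A binary quadratic form over the complex numbers has a nontrivial zero. If
  \<open>p\<close> is not one, \<open>r p + q\<close> is for a suitable \<open>r\<close>, and
  \<open>p\<close> serves as its partner.\<close>

lemma isotropic_eigenvector:
  obtains p' q' where "pencil_eigen A B \<alpha> p'" "pencil_eigen A B \<alpha> q'" "indep2 p' q'"
    "bform (cmat A) p' p' = 0"
proof (cases "bform (cmat A) p p = 0")
  case True
  thus ?thesis using that p q indep by blast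
next
  case False
  note carr = pq_carrier
  define g h k where "g = bform (cmat A) p p" and "h = bform (cmat A) p q" and "k = bform (cmat A) q q"
  define s where "s = csqrt (h\<^sup>2 - g * k)"
  \<comment> \<open>A root of \<open>g * r^2 + 2 * h * r + k\<close>, the value of the form at
    \<open>r p + q\<close>.\<close>
  define r where "r = (s - h) / g"
  have g: "g \<noteq> 0" using False by (simp add: g_def)
  have "g * (r * r * g + 2 * r * h + k) = (g * r)\<^sup>2 + 2 * h * (g * r) + g * k"
    by (simp add: power2_eq_square algebra_simps)
  also have "g * r = s - h" using g by (simp add: r_def)
  also have "(s - h)\<^sup>2 + 2 * h * (s - h) + g * k = s\<^sup>2 - (h\<^sup>2 - g * k)"
    by (simp add: power2_eq_square algebra_simps)
  also have "\<dots> = 0" by (simp add: s_def)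
  finally have "r * r * g + 2 * r * h + k = 0" using g by simp
  moreover have "bform (cmat A) q p = h" using bform_sym[OF cA symcA carr] by (simp add: h_def)
  ultimately have "bform (cmat A) (r \<cdot>\<^sub>v p + 1 \<cdot>\<^sub>v q) (r \<cdot>\<^sub>v p + 1 \<cdot>\<^sub>v q) = 0"
    using carr by (simp add: bform_linear[OF cA] g_def h_def k_def algebra_simps)
  moreover have "pencil_eigen A B \<alpha> (r \<cdot>\<^sub>v p + 1 \<cdot>\<^sub>v q)" by (rule eigen_comb[OF p q])
  moreover
  have eq: "a \<cdot>\<^sub>v (r \<cdot>\<^sub>v p + 1 \<cdot>\<^sub>v q) + b \<cdot>\<^sub>v p = (a * r + b) \<cdot>\<^sub>v p + a \<cdot>\<^sub>v q" for a b
    using carr by (intro eq_vecI) (auto simp: algebra_simps)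
  have "indep2 (r \<cdot>\<^sub>v p + 1 \<cdot>\<^sub>v q) p" 
    using indep unfolding indep2_def eq by fastforce
  ultimately show ?thesis using that p by blast
qed

text \<open>As \<open>p\<close> is isotropic, the form at \<open>r p + q\<close> is affine in
  \<open>r\<close> with slope \<open>2 * h\<close>, which is nonzero, so it has a zero.\<close>

lemma isotropic_complement:
  assumes iso: "bform (cmat A) p p = 0"
  obtains q' where "pencil_eigen A B \<alpha> q'" "indep2 p q'" "bform (cmat A) q' q' = 0"
proof -
  note carr = pq_carrier
  define h where "h = bform (cmat A) p q"
  define r where "r = - bform (cmat A) q q / (2 * h)"
  have h: "h \<noteq> 0" using bform_pq_nonzero[OF iso] by (simp add: h_def)
  have "bform (cmat A) q p = h" using bform_sym[OF cA symcA carr] by (simp add: h_def)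
  hence "bform (cmat A) (r \<cdot>\<^sub>v p + 1 \<cdot>\<^sub>v q) (r \<cdot>\<^sub>v p + 1 \<cdot>\<^sub>v q) = 2 * r * h + bform (cmat A) q q"
    using carr iso by (simp add: bform_linear[OF cA] h_def algebra_simps)
  hence "bform (cmat A) (r \<cdot>\<^sub>v p + 1 \<cdot>\<^sub>v q) (r \<cdot>\<^sub>v p + 1 \<cdot>\<^sub>v q) = 0"
    using h by (simp add: r_def)
  moreover have "pencil_eigen A B \<alpha> (r \<cdot>\<^sub>v p + 1 \<cdot>\<^sub>v q)" by (rule eigen_comb[OF p q])
  moreover
  have eq: "a \<cdot>\<^sub>v p + b \<cdot>\<^sub>v (r \<cdot>\<^sub>v p + 1 \<cdot>\<^sub>v q) = (a + b * r) \<cdot>\<^sub>v p + b \<cdot>\<^sub>v q" for a b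
    using carr by (intro eq_vecI) (auto simp: algebra_simps)
  have "indep2 p (r \<cdot>\<^sub>v p + 1 \<cdot>\<^sub>v q)" 
    using indep unfolding indep2_def eq by fastforce
  ultimately show ?thesis using that by blast
qed

end
end

section \<open>The intersection curve in an isotropic frame\<close>

lemma is_line_span2:
  "u \<in> carrier_vec 4 \<Longrightarrow> v \<in> carrier_vec 4 \<Longrightarrow> indep2 u v \<Longrightarrow> is_line (span2 u v)"
  unfolding is_line_def indep2_def by blast

text \<open>Combinations of \<open>p\<close> and \<open>conjugate p\<close> with conjugate
  coefficients are real vectors. The coefficients \<open>1 + t i\<close> and \<open>1 - t i\<close>
  give a different projective point for each real \<open>t\<close>.\<close>

lemma span2_conjugate_real_line:
  assumes p: "p \<in> carrier_vec 4" and indep: "indep2 p (conjugate p)"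
  shows "real_line (span2 p (conjugate p))"
proof -
  define w where "w t = Complex 1 t \<cdot>\<^sub>v p + Complex 1 (- t) \<cdot>\<^sub>v conjugate p" for t
  have "proj_pt (w t) \<in> real_points (span2 p (conjugate p))" for t
  proof -
    have "w t \<in> span2 p (conjugate p)" by (auto simp: w_def span2_def)
    moreover have "w t \<noteq> 0\<^sub>v 4"
      using indep unfolding w_def indep2_def by (force simp: complex_eq_iff)
    moreover have "w t $ i \<in> \<real>" if "i < 4" for i
      using that p by (simp add: w_def complex_is_Real_iff conjugate_complex_def)
    ultimately show ?thesis by (auto simp: real_points_def)
  qed
  moreover have "inj (\<lambda>t. proj_pt (w t))"
  proof (rule injI)
    fix s t assume "proj_pt (w s) = proj_pt (w t)"
    moreover have "w s = 1 \<cdot>\<^sub>v w s" by simp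
    ultimately obtain k where k: "w s = k \<cdot>\<^sub>v w t" unfolding proj_pt_def by blast
    have "(Complex 1 s - k * Complex 1 t) \<cdot>\<^sub>v p + (Complex 1 (- s) - k * Complex 1 (- t)) \<cdot>\<^sub>v conjugate p = 0\<^sub>v 4"
    proof (rule eq_vecI)
      fix i assume "i < dim_vec (0\<^sub>v 4 :: complex vec)"
      thus "((Complex 1 s - k * Complex 1 t) \<cdot>\<^sub>v p + (Complex 1 (- s) - k * Complex 1 (- t)) \<cdot>\<^sub>v conjugate p) $ i
          = 0\<^sub>v 4 $ i"
        using arg_cong[OF k, of "\<lambda>x. x $ i"] p by (simp add: w_def algebra_simps)
    qed (use p in simp)
    hence "Complex 1 s - k * Complex 1 t = 0 \<and> Complex 1 (- s) - k * Complex 1 (- t) = 0"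
      using indep unfolding indep2_def by blast
    hence eqs: "Complex 1 s = k * Complex 1 t" "Complex 1 (- s) = k * Complex 1 (- t)"
      by auto
    \<comment> \<open>Adding both equations cancels the imaginary parts and leaves
      \<open>2 = 2 * k\<close>.\<close>
    have "Complex 1 s + Complex 1 (- s) = k * (Complex 1 t + Complex 1 (- t))"
      unfolding eqs by (simp add: algebra_simps)
    hence "k = 1" by (simp add: complex_eq_iff)
    with eqs(1) show "s = t" by simp
  qed
  ultimately have "infinite (range (\<lambda>t. proj_pt (w t)))" "range (\<lambda>t. proj_pt (w t)) \<subseteq> real_points (span2 p (conjugate p))"
    by (auto simp: finite_image_iff infinite_UNIV_char_0 dest: finite_imageD)
  thus ?thesis unfolding real_line_def using finite_subset by blast
qed

section \<open>Both quadrics and the four lines in frame coordinates\<close>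

locale isotropic_pencil = symmetric_pencil +
  fixes p q :: "complex vec"
  assumes p: "pencil_eigen A B \<alpha> p" and q: "pencil_eigen A B \<alpha> q" and indep: "indep2 p q"
    and isop: "bform (cmat A) p p = 0" and isoq: "bform (cmat A) q q = 0"
begin

lemmas carr = pq_carrier[OF p q indep]
lemmas independent = comb4_zero[OF p q indep]

lemma comb4_carrier: "comb4 p q a b c d \<in> carrier_vec 4"
  using carr by (simp add: comb4_def)

text \<open>Together with \<open>isop\<close> and \<open>isoq\<close>, the Gram matrix of
  \<open>A\<close> in the frame: everything vanishes except the pairing of \<open>p\<close> with
  \<open>q\<close> and its conjugate.\<close>

lemma bform_table:
  "bform (cmat A) (conjugate p) (conjugate p) = 0" "bform (cmat A) (conjugate q) (conjugate q) = 0"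
  "bform (cmat A) (conjugate p) (conjugate q) = cnj (bform (cmat A) p q)"
  "bform (cmat A) q p = bform (cmat A) p q"
  "bform (cmat A) (conjugate q) (conjugate p) = cnj (bform (cmat A) p q)"
  "bform (cmat A) p (conjugate p) = 0" "bform (cmat A) p (conjugate q) = 0"
  "bform (cmat A) q (conjugate p) = 0" "bform (cmat A) q (conjugate q) = 0"
  "bform (cmat A) (conjugate p) p = 0" "bform (cmat A) (conjugate q) p = 0"
  "bform (cmat A) (conjugate p) q = 0" "bform (cmat A) (conjugate q) q = 0"
proof -
  show qp: "bform (cmat A) q p = bform (cmat A) p q" using bform_sym[OF cA symcA] carr by simp
  show "bform (cmat A) p (conjugate p) = 0" "bform (cmat A) p (conjugate q) = 0"
    "bform (cmat A) q (conjugate p) = 0" "bform (cmat A) q (conjugate q) = 0"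
    using bform_eigen_orthogonal[OF _ _ nonreal] eigen_conjugate p q by blast+
  show "bform (cmat A) (conjugate p) p = 0" "bform (cmat A) (conjugate q) p = 0"
    "bform (cmat A) (conjugate p) q = 0" "bform (cmat A) (conjugate q) q = 0"
    using bform_eigen_orthogonal[OF _ _ nonreal[symmetric]] eigen_conjugate p q by blast+
qed (use bform_conjugate[OF A] carr isop isoq bform_sym[OF cA symcA, of q p] in simp_all)

lemma bform_comb4:
  "bform (cmat A) (comb4 p q a b c d) (comb4 p q a b c d)
    = 2 * (a * b) * bform (cmat A) p q + 2 * (c * d) * cnj (bform (cmat A) p q)"
  "bform (cmat B) (comb4 p q a b c d) (comb4 p q a b c d)
    = 2 * (a * b) * \<alpha> * bform (cmat A) p q + 2 * (c * d) * cnj \<alpha> * cnj (bform (cmat A) p q)"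
proof -
  note lin = bform_linear[OF cA] bform_linear[OF cB]
  show "bform (cmat A) (comb4 p q a b c d) (comb4 p q a b c d)
    = 2 * (a * b) * bform (cmat A) p q + 2 * (c * d) * cnj (bform (cmat A) p q)"
    using carr by (simp add: comb4_def lin bform_table isop isoq algebra_simps)
  show "bform (cmat B) (comb4 p q a b c d) (comb4 p q a b c d)
    = 2 * (a * b) * \<alpha> * bform (cmat A) p q + 2 * (c * d) * cnj \<alpha> * cnj (bform (cmat A) p q)"
    using carr
    by (simp add: comb4_def lin bform_eigen[OF _ p] bform_eigen[OF _ q]
      bform_eigen[OF _ eigen_conjugate[OF p]] bform_eigen[OF _ eigen_conjugate[OF q]]
      bform_table isop isoq algebra_simps)
qed

text \<open>The two quadrics give a linear system in \<open>a * b * h\<close> and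
  \<open>c * d * cnj h\<close>. It has only the zero solution because \<alpha> is not real, and
  \<open>h\<close> is nonzero.\<close>

lemma comb4_in_qsic:
  assumes "comb4 p q a b c d \<noteq> 0\<^sub>v 4"
  shows "comb4 p q a b c d \<in> qsic A B \<longleftrightarrow> a * b = 0 \<and> c * d = 0"
proof -
  define h where "h = bform (cmat A) p q"
  have h: "h \<noteq> 0" using bform_pq_nonzero[OF p q indep isop] by (simp add: h_def)
  have "a * b = 0 \<and> c * d = 0"
    if 1: "2 * (a * b) * h + 2 * (c * d) * cnj h = 0"
    and 2: "2 * (a * b) * \<alpha> * h + 2 * (c * d) * cnj \<alpha> * cnj h = 0"
  proof -
    have cd: "2 * (c * d) * cnj h = - (2 * (a * b) * h)" using 1 by (simp add: eq_neg_iff_add_eq_0 add.commute)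
    \<comment> \<open>The equation of \<open>B\<close> minus \<open>cnj \<alpha>\<close> times that
      of \<open>A\<close>.\<close>
    have "(\<alpha> - cnj \<alpha>) * (2 * (a * b) * h) = 2 * (a * b) * \<alpha> * h + cnj \<alpha> * (2 * (c * d) * cnj h)"
      unfolding cd by (simp add: algebra_simps)
    also have "\<dots> = 0" using 2 by (simp add: algebra_simps)
    finally have "a * b = 0" using nonreal h by auto
    with 1 h show ?thesis by auto
  qed
  thus ?thesis
    using assms comb4_carrier[of a b c d] bform_comb4[of a b c d] unfolding qsic_def bform_def[symmetric] h_def by auto
qed

lemma pair_comb4:
  "a \<cdot>\<^sub>v p + c \<cdot>\<^sub>v conjugate p = comb4 p q a 0 c 0" "a \<cdot>\<^sub>v q + c \<cdot>\<^sub>v conjugate q = comb4 p q 0 a 0 c"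
  "a \<cdot>\<^sub>v p + c \<cdot>\<^sub>v conjugate q = comb4 p q a 0 0 c" "a \<cdot>\<^sub>v q + c \<cdot>\<^sub>v conjugate p = comb4 p q 0 a c 0"
  using carr by (auto intro!: eq_vecI simp: comb4_def)

lemmas span2_comb4 =
  span2_def[of p "conjugate p", unfolded pair_comb4] span2_def[of q "conjugate q", unfolded pair_comb4]
  span2_def[of p "conjugate q", unfolded pair_comb4] span2_def[of q "conjugate p", unfolded pair_comb4]

lemma comb4_diff:
  "comb4 p q a b c d - comb4 p q a' b' c' d' = comb4 p q (a - a') (b - b') (c - c') (d - d')"
  using carr by (intro eq_vecI) (auto simp: comb4_def algebra_simps)

lemma comb4_eq:
  assumes "comb4 p q a b c d = comb4 p q a' b' c' d'"
  shows "a = a' \<and> b = b' \<and> c = c' \<and> d = d'"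
proof -
  have "comb4 p q (a - a') (b - b') (c - c') (d - d') = 0\<^sub>v 4"
    using assms minus_cancel_vec[OF comb4_carrier] unfolding comb4_diff[symmetric] by simp
  thus ?thesis using independent by fastforce
qed

lemma comb4_all_zero: "comb4 p q 0 0 0 0 = 0\<^sub>v 4"
  using carr by (intro eq_vecI) (auto simp: comb4_def)

lemma conjugate_comb4: "conjugate (comb4 p q a b c d) = comb4 p q (cnj c) (cnj d) (cnj a) (cnj b)"
  using carr by (intro eq_vecI) (auto simp: comb4_def conjugate_complex_def)

lemma indep2_pairs:
  "indep2 p (conjugate p)" "indep2 q (conjugate q)" "indep2 p (conjugate q)" "indep2 q (conjugate p)"
  unfolding indep2_def pair_comb4 using independent by blast+

text \<open>Conjugation fixes real vectors and exchanges the two halves of the frame; coordinates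
  are unique.\<close>

lemma real_comb4:
  assumes "\<forall>i<4. comb4 p q a b c d $ i \<in> \<real>"
  shows "c = cnj a \<and> d = cnj b"
proof -
  have "conjugate (comb4 p q a b c d) = comb4 p q a b c d"
    using assms carr by (intro eq_vecI) (auto simp: comb4_def conjugate_complex_def Reals_cnj_iff)
  thus ?thesis unfolding conjugate_comb4 using comb4_eq by fastforce
qed

text \<open>A real vector has \<open>c = cnj a\<close> and \<open>d = cnj b\<close>, while on these
  lines one member of each of the pairs \<open>a, c\<close> and \<open>b, d\<close> is 0. So these
  lines contain no real point at all.\<close>

lemma not_real_lines:
  "\<not> real_line (span2 p (conjugate q))" "\<not> real_line (span2 q (conjugate p))"
proof -
  have "w = 0\<^sub>v 4" if w: "w \<in> span2 p (conjugate q) \<union> span2 q (conjugate p)" and real: "\<forall>i<4. w $ i \<in> \<real>" for w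
  proof -
    obtain a b c d where w: "w = comb4 p q a b c d" and "b = 0 \<and> c = 0 \<or> a = 0 \<and> d = 0"
      using w unfolding span2_comb4 by blast
    moreover have "c = cnj a \<and> d = cnj b" using real unfolding w by (rule real_comb4)
    ultimately have "a = 0 \<and> b = 0 \<and> c = 0 \<and> d = 0" by auto
    thus ?thesis using w comb4_all_zero by simp
  qed
  hence "real_points (span2 p (conjugate q)) = {}" "real_points (span2 q (conjugate p)) = {}"
    unfolding real_points_def by blast+
  thus "\<not> real_line (span2 p (conjugate q))" "\<not> real_line (span2 q (conjugate p))"
    by (simp_all add: real_line_def)
qed

lemma real_lines:
  "real_line (span2 p (conjugate p))" "real_line (span2 q (conjugate q))"
  using indep2_pairs carr by (auto intro: span2_conjugate_real_line)

lemma skew_lines: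
  "span2 p (conjugate p) \<inter> span2 q (conjugate q) = {0\<^sub>v 4}"
  "span2 p (conjugate q) \<inter> span2 q (conjugate p) = {0\<^sub>v 4}"
  unfolding span2_comb4 comb4_all_zero[symmetric] using comb4_eq by blast+

text \<open>The equations \<open>a * b = 0\<close> and \<open>c * d = 0\<close> leave one of
  \<open>p\<close>, \<open>q\<close> and one of their conjugates, and each of the four choices spans
  a line.\<close>

lemma qsic_four_lines:
  "qsic A B = (span2 p (conjugate p) \<union> span2 q (conjugate q) \<union> span2 p (conjugate q) \<union> span2 q (conjugate p)) - {0\<^sub>v 4}"
    (is "_ = ?L - _")
proof (rule Set.set_eqI)
  fix x
  show "x \<in> qsic A B \<longleftrightarrow> x \<in> ?L - {0\<^sub>v 4}"
  proof (cases "x \<in> carrier_vec 4 \<and> x \<noteq> 0\<^sub>v 4")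
    case True
    then obtain a b c d where x: "x = comb4 p q a b c d" using comb4_span[OF p q indep] by metis
    have "x \<in> ?L \<longleftrightarrow> a * b = 0 \<and> c * d = 0"
      unfolding x span2_comb4 by (auto dest: comb4_eq)
    thus ?thesis using True comb4_in_qsic[of a b c d] by (simp add: x)
  next
    case False
    have "?L \<subseteq> carrier_vec 4" using carr by (auto simp: span2_def)
    thus ?thesis using False by (auto simp: qsic_def)
  qed
qed

section \<open>The index of the real members of the pencil\<close>

text \<open>The span of \<open>p\<close> and \<open>conjugate p\<close> is closed under conjugation,
  and the bilinear forms of \<open>A\<close> and \<open>B\<close> vanish on it. Hence the Hermitian
  form of \<open>l A - B\<close> vanishes there too.\<close>

lemma Id_pencil_eq_2: "Id_pencil A B l = 2"
  unfolding Id_pencil_def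
proof (rule num_pos_eig_isotropic_plane)
  let ?K = "l \<cdot>\<^sub>m A - B"
  show K: "?K \<in> carrier_mat 4 4" by (rule minus_carrier_mat[OF B])
  have "A $$ (j, i) = A $$ (i, j)" "B $$ (j, i) = B $$ (i, j)" if "i < 4" "j < 4" for i j
    using arg_cong[OF symA, of "\<lambda>M. M $$ (i, j)"] arg_cong[OF symB, of "\<lambda>M. M $$ (i, j)"] A B that by simp_all
  thus "?K\<^sup>T = ?K" using A B by (intro eq_matI) auto
  have Kx: "cmat ?K *\<^sub>v x = complex_of_real l \<cdot>\<^sub>v (cmat A *\<^sub>v x) + (- 1) \<cdot>\<^sub>v (cmat B *\<^sub>v x)"
    if "x \<in> carrier_vec 4" for x
    using A B that by (intro eq_vecI) (auto simp: cmat_def scalar_prod_def sum_distrib_left sum_subtractf sum_negf algebra_simps)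
  have bK: "bform (cmat ?K) x y = complex_of_real l * bform (cmat A) x y - bform (cmat B) x y"
    if "x \<in> carrier_vec 4" "y \<in> carrier_vec 4" for x y
    using that cA cB by (simp add: bform_def Kx scalar_prod_add_distrib[of _ 4])
  have cK: "cmat ?K \<in> carrier_mat 4 4" using K by (simp add: cmat_def)
  show "p \<in> carrier_vec 4" "conjugate p \<in> carrier_vec 4" using carr by auto
  show "a = 0 \<and> b = 0" if "a \<cdot>\<^sub>v p + b \<cdot>\<^sub>v conjugate p = 0\<^sub>v 4" for a b
    using that indep2_pairs(1) by (simp add: indep2_def)
  show "(cmat ?K *\<^sub>v (a \<cdot>\<^sub>v p + b \<cdot>\<^sub>v conjugate p)) \<bullet>c (a \<cdot>\<^sub>v p + b \<cdot>\<^sub>v conjugate p) = 0" for a b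
  proof -
    have "(cmat ?K *\<^sub>v (a \<cdot>\<^sub>v p + b \<cdot>\<^sub>v conjugate p)) \<bullet>c (a \<cdot>\<^sub>v p + b \<cdot>\<^sub>v conjugate p)
      = bform (cmat ?K) (conjugate (a \<cdot>\<^sub>v p + b \<cdot>\<^sub>v conjugate p)) (a \<cdot>\<^sub>v p + b \<cdot>\<^sub>v conjugate p)"
      using carr cK by (simp add: bform_def comm_scalar_prod[of _ 4])
    also have "\<dots> = 0"
    proof -
      have "conjugate (a \<cdot>\<^sub>v p + b \<cdot>\<^sub>v conjugate p) = cnj b \<cdot>\<^sub>v p + cnj a \<cdot>\<^sub>v conjugate p"
        using carr by (intro eq_vecI) (auto simp: conjugate_complex_def)
      thus ?thesis
        using carr by (simp add: bform_linear[OF cA] bform_linear[OF cB] bK bform_eigen[OF _ p]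
          bform_eigen[OF _ eigen_conjugate[OF p]] bform_table isop)
    qed
    finally show ?thesis .
  qed
  show "x = 0\<^sub>v 4" if x: "x \<in> carrier_vec 4" and x0: "cmat ?K *\<^sub>v x = 0\<^sub>v 4" for x
  proof -
    obtain a b c d where xc: "x = comb4 p q a b c d" using comb4_span[OF p q indep x] .
    let ?s = "complex_of_real l - \<alpha>"
    have comb: "cmat M *\<^sub>v comb4 p q a b c d
        = (a \<cdot>\<^sub>v (cmat M *\<^sub>v p) + b \<cdot>\<^sub>v (cmat M *\<^sub>v q)) + (c \<cdot>\<^sub>v (cmat M *\<^sub>v conjugate p) + d \<cdot>\<^sub>v (cmat M *\<^sub>v conjugate q))"
      if "cmat M \<in> carrier_mat 4 4" for M a b c d
      using carr by (simp add: comb4_def mult_add_distrib_mat_vec[OF that] mult_mat_vec[OF that]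
        del: assoc_add_vec)
    define u where "u = cmat A *\<^sub>v p"
    define v where "v = cmat A *\<^sub>v q"
    define u' where "u' = cmat A *\<^sub>v conjugate p"
    define v' where "v' = cmat A *\<^sub>v conjugate q"
    note uv = u_def[symmetric] v_def[symmetric] u'_def[symmetric] v'_def[symmetric]
    have uv_carrier: "u \<in> carrier_vec 4" "v \<in> carrier_vec 4" "u' \<in> carrier_vec 4" "v' \<in> carrier_vec 4"
      using carr cA by (simp_all add: u_def v_def u'_def v'_def)
    have Bev: "cmat B *\<^sub>v p = \<alpha> \<cdot>\<^sub>v u" "cmat B *\<^sub>v q = \<alpha> \<cdot>\<^sub>v v"
      "cmat B *\<^sub>v conjugate p = cnj \<alpha> \<cdot>\<^sub>v u'" "cmat B *\<^sub>v conjugate q = cnj \<alpha> \<cdot>\<^sub>v v'"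
      using p q eigen_conjugate[OF p] eigen_conjugate[OF q]
      by (simp_all add: pencil_eigen_def u_def v_def u'_def v'_def)
    \<comment> \<open>In the frame, \<open>l A - B\<close> acts as \<open>A\<close> after scaling
      the coordinates by \<open>l - \<alpha>\<close> and its conjugate, both nonzero since
      \<open>l\<close> is real.\<close>
    have "cmat ?K *\<^sub>v x = cmat A *\<^sub>v comb4 p q (?s * a) (?s * b) (cnj ?s * c) (cnj ?s * d)"
      unfolding Kx[OF x] unfolding xc comb[OF cA] comb[OF cB] Bev uv
      using uv_carrier by (intro eq_vecI) (auto simp: algebra_simps)
    from trans[OF this[symmetric] x0]
    have "comb4 p q (?s * a) (?s * b) (cnj ?s * c) (cnj ?s * d) = 0\<^sub>v 4"
      by (rule injA[OF comb4_carrier])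
    hence "?s * a = 0 \<and> ?s * b = 0 \<and> cnj ?s * c = 0 \<and> cnj ?s * d = 0" by (rule independent)
    moreover have "?s \<noteq> 0" "cnj ?s \<noteq> 0" using nonreal by (auto simp: complex_eq_iff)
    ultimately show ?thesis unfolding xc using comb4_all_zero by simp
  qed
qed

end

section \<open>From the Segre characteristic to an isotropic frame\<close>

lemma (in symmetric_pencil) isotropic_pencil_exists:
  assumes p: "pencil_eigen A B \<alpha> p" and q: "pencil_eigen A B \<alpha> q" and indep: "indep2 p q"
  obtains p' q' where "isotropic_pencil A B \<alpha> p' q'"
proof -
  obtain p' q' where 1: "pencil_eigen A B \<alpha> p'" "pencil_eigen A B \<alpha> q'" "indep2 p' q'"
    "bform (cmat A) p' p' = 0"
    using isotropic_eigenvector[OF p q indep] .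
  obtain q'' where 2: "pencil_eigen A B \<alpha> q''" "indep2 p' q''" "bform (cmat A) q'' q'' = 0"
    using isotropic_complement[OF 1] .
  have "isotropic_pencil A B \<alpha> p' q''" by unfold_locales (use 1 2 in auto)
  thus ?thesis using that by blast
qed

theorem theorem20:
  fixes A B :: "real mat"
  assumes A: "A \<in> carrier_mat 4 4" and B: "B \<in> carrier_mat 4 4"
    and symA: "A\<^sup>T = A" and symB: "B\<^sup>T = B"
    and f_nz: "pencil_poly A B \<noteq> 0"
    and roots: "\<exists>\<alpha> c. Im \<alpha> \<noteq> 0 \<and>
        map_poly complex_of_real (pencil_poly A B) = Polynomial.smult c ([:-\<alpha>, 1:]^2 * [:-cnj \<alpha>, 1:]^2) \<and>
        (\<exists>Ai \<in> carrier_mat 4 4. Ai * A = 1\<^sub>m 4 \<and>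
           jordan_nf (cmat (Ai * B)) [(1, \<alpha>), (1, \<alpha>), (1, cnj \<alpha>), (1, cnj \<alpha>)])"
  shows "(\<forall>lam. Id_pencil A B lam = 2) \<and>
    (\<exists>L1 L2 L3 L4. is_line L1 \<and> is_line L2 \<and> is_line L3 \<and> is_line L4 \<and>
       real_line L1 \<and> real_line L2 \<and> \<not> real_line L3 \<and> \<not> real_line L4 \<and>
       L1 \<inter> L2 = {0\<^sub>v 4} \<and> L3 \<inter> L4 = {0\<^sub>v 4} \<and>
       qsic A B = (L1 \<union> L2 \<union> L3 \<union> L4) - {0\<^sub>v 4})"
proof -
  obtain \<alpha> Ai where \<alpha>: "Im \<alpha> \<noteq> 0" and Ai: "Ai \<in> carrier_mat 4 4" "Ai * A = 1\<^sub>m 4"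
    and jnf: "jordan_nf (cmat (Ai * B)) (map (Pair 1) [\<alpha>, \<alpha>, cnj \<alpha>, cnj \<alpha>])"
    using roots by auto
  have cmat_mult: "cmat (M * N) = cmat M * cmat N" if "M \<in> carrier_mat 4 4" "N \<in> carrier_mat 4 4" for M N
    unfolding cmat_def by (rule of_real_hom.mat_hom_mult[OF that])
  have cmat_carrier: "cmat M \<in> carrier_mat 4 4" if "M \<in> carrier_mat 4 4" for M
    using that by (simp add: cmat_def)
  have cmat_one: "cmat (1\<^sub>m 4) = 1\<^sub>m 4" unfolding cmat_def by (rule of_real_hom.mat_hom_one)
  have "A * Ai = 1\<^sub>m 4" using mat_mult_left_right_inverse[OF Ai(1) A Ai(2)] .
  \<comment> \<open>This turns eigenvectors of the inverse of \<open>A\<close> times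
    \<open>B\<close> into eigenvectors of the pencil.\<close>
  hence AM: "cmat A * cmat (Ai * B) = cmat B"
    using A B Ai(1) by (simp flip: cmat_mult assoc_mult_mat)
  interpret symmetric_pencil A B \<alpha>
  proof
    show "x = 0\<^sub>v 4" if "x \<in> carrier_vec 4" "cmat A *\<^sub>v x = 0\<^sub>v 4" for x
    proof -
      have "x = cmat (Ai * A) *\<^sub>v x" using that by (simp add: Ai(2) cmat_one)
      also have "\<dots> = cmat Ai *\<^sub>v (cmat A *\<^sub>v x)"
        unfolding cmat_mult[OF Ai(1) A]
        by (rule assoc_mult_mat_vec[OF cmat_carrier[OF Ai(1)] cmat_carrier[OF A] that(1)])
      finally show ?thesis using that mult_mat_vec_zero[OF cmat_carrier[OF Ai(1)]] by simp
    qed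
    show "\<alpha> \<noteq> cnj \<alpha>" using \<alpha> by (simp add: complex_eq_iff)
  qed (use A B symA symB in auto)
  have cM: "cmat (Ai * B) \<in> carrier_mat 4 4" using cmat_carrier Ai(1) B by simp
  obtain P Q where P: "P \<in> carrier_mat 4 4" and Q: "Q \<in> carrier_mat 4 4" and "Q * P = 1\<^sub>m 4"
    and ev: "\<And>i. i < 4 \<Longrightarrow> cmat (Ai * B) *\<^sub>v col P i = [\<alpha>, \<alpha>, cnj \<alpha>, cnj \<alpha>] ! i \<cdot>\<^sub>v col P i"
    using eigenspace_basis[OF cM jnf] by metis
  \<comment> \<open>Columns 0 and 1 of \<open>P\<close> belong to the two blocks with eigenvalue
    \<alpha>.\<close>
  have eigen: "pencil_eigen A B \<alpha> (col P i)" if "i < 2" for i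
  proof -
    have i: "col P i \<in> carrier_vec 4" "[\<alpha>, \<alpha>, cnj \<alpha>, cnj \<alpha>] ! i = \<alpha>"
      using that col_carrier_vec[OF _ P] by (auto simp: less_2_cases_iff)
    have "cmat B *\<^sub>v col P i = cmat A *\<^sub>v (cmat (Ai * B) *\<^sub>v col P i)"
      using assoc_mult_mat_vec[OF cA cM i(1)] by (simp add: AM)
    also have "\<dots> = \<alpha> \<cdot>\<^sub>v (cmat A *\<^sub>v col P i)"
      using ev[of i] that i mult_mat_vec[OF cA i(1)] by simp
    finally show ?thesis using i by (simp add: pencil_eigen_def)
  qed
  have "indep2 (col P 0) (col P 1)"
    unfolding indep2_def
  proof (intro allI impI)
    fix a b assume 0: "a \<cdot>\<^sub>v col P 0 + b \<cdot>\<^sub>v col P 1 = 0\<^sub>v 4"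
    \<comment> \<open>Applying \<open>Q\<close> turns a relation between columns of \<open>P\<close>
      into one between unit vectors.\<close>
    have Qcol: "Q *\<^sub>v col P i = unit_vec 4 i" if "i < 4" for i
      using col_mult2[OF Q P that] that by (simp add: \<open>Q * P = 1\<^sub>m 4\<close>)
    have c: "col P 0 \<in> carrier_vec 4" "col P 1 \<in> carrier_vec 4"
      using col_carrier_vec[OF _ P] by simp_all
    have "Q *\<^sub>v (a \<cdot>\<^sub>v col P 0 + b \<cdot>\<^sub>v col P 1) = a \<cdot>\<^sub>v unit_vec 4 0 + b \<cdot>\<^sub>v unit_vec 4 1"
      using c by (simp add: mult_add_distrib_mat_vec[OF Q] mult_mat_vec[OF Q] Qcol del: One_nat_def)
    hence "a \<cdot>\<^sub>v unit_vec 4 0 + b \<cdot>\<^sub>v unit_vec 4 1 = (0\<^sub>v 4 :: complex vec)"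
      using 0 mult_mat_vec_zero[OF Q] by simp
    from arg_cong[OF this, of "\<lambda>v. v $ 0"] arg_cong[OF this, of "\<lambda>v. v $ 1"]
    show "a = 0 \<and> b = 0" by simp
  qed
  then obtain p q where "isotropic_pencil A B \<alpha> p q"
    using isotropic_pencil_exists eigen by (metis one_less_numeral_iff semiring_norm(76) zero_less_numeral)
  then interpret isotropic_pencil A B \<alpha> p q .
  have "is_line (span2 p (conjugate p))" "is_line (span2 q (conjugate q))"
    "is_line (span2 p (conjugate q))" "is_line (span2 q (conjugate p))"
    using is_line_span2 indep2_pairs carr by auto
  thus ?thesis
    using Id_pencil_eq_2 real_lines not_real_lines skew_lines qsic_four_lines by blast
qed

end
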